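(* Let $R$ be a commutative ring with identity, and let $\tau_w=(\mathcal{T}_{\mathrm{GV}},\mathcal{F}_{\mathrm{GV}})$, where $\mathcal{T}_{\mathrm{GV}}$ (resp. $\mathcal{F}_{\mathrm{GV}}$) is the class of all $\mathrm{GV}$-torsion (resp. $\mathrm{GV}$-torsion-free) $R$-modules. Then $\tau_w$ is a hereditary torsion theory on the category of $R$-modules, and the corresponding Gabriel filter $\mathfrak{F}_{\tau_w}$ consists of exactly the ideals of $R$ that contain a $\mathrm{GV}$-ideal.
   Context: A $\mathrm{GV}$-ideal of $R$ is a finitely generated ideal $J$ such that the natural map $R\to\operatorname{Hom}_R(J,R)$, $r\mapsto(a\mapsto ra)$, is an isomorphism; $\mathrm{GV}(R)$ is the set of all $\mathrm{GV}$-ideals; it is a multiplicative system of ideals (closed under products). For an $R$-module $M$, $\operatorname{tor}_{\mathrm{GV}}(M)=\{x\in M\mid Jx=0\text{ for some }J\in\mathrm{GV}(R)\}$, a submodule of $M$. $M$ is $\mathrm{GV}$-torsion if $\operatorname{tor}_{\mathrm{GV}}(M)=M$ and $\mathrm{GV}$-torsion-free if $\operatorname{tor}_{\mathrm{GV}}(M)=0$. A pair $(\mathcal{T},\mathcal{F})$ of classes of $R$-modules is a torsion theory if $\mathcal{T}\cap\mathcal{F}=\{0\}$, $\mathcal{T}$ is closed under homomorphic images, $\mathcal{F}$ is closed under submodules, and every module $M$ fits in an exact sequence $0\to T\to M\to F\to 0$ with $T\in\mathcal{T}$, $F\in\mathcal{F}$. It is hereditary if $\mathcal{T}$ is closed under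 submodules. The corresponding Gabriel filter is the set of ideals $I$ of $R$ with $R/I\in\mathcal{T}$. *)

theory Defs
  imports "HOL-Algebra.Module" "HOL-Algebra.QuotRing"
begin

(* Modules over a record ring R are records of type ('a, 'm) module satisfying the library's
   locale predicate "module R M".  Such records also carry ring fields mult and one; they play
   no role for the module structure. *)

definition mod_hom ::
    "('a, 'e) ring_scheme \<Rightarrow> ('a, 'm) module \<Rightarrow> ('a, 'n) module \<Rightarrow> ('m \<Rightarrow> 'n) set"
  where "mod_hom R M N =
    {f \<in> hom (add_monoid M) (add_monoid N).
       \<forall>r\<in>carrier R. \<forall>x\<in>carrier M. f (r \<odot>\<^bsub>M\<^esub> x) = r \<odot>\<^bsub>N\<^esub> f x}"

definition mod_iso ::
    "('a, 'e) ring_scheme \<Rightarrow> ('a, 'm) module \<Rightarrow> ('a, 'n) module \<Rightarrow> ('m \<Rightarrow> 'n) set"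
  where "mod_iso R M N = {f \<in> mod_hom R M N. bij_betw f (carrier M) (carrier N)}"

definition regular_module :: "('a, 'e) ring_scheme \<Rightarrow> ('a, 'a) module"
  where "regular_module R =
    \<lparr>carrier = carrier R, mult = mult R, one = one R, zero = zero R, add = add R,
     smult = mult R\<rparr>"

definition ideal_module :: "('a, 'e) ring_scheme \<Rightarrow> 'a set \<Rightarrow> ('a, 'a) module"
  where "ideal_module R J = (regular_module R)\<lparr>carrier := J\<rparr>"

definition quot_module :: "('a, 'e) ring_scheme \<Rightarrow> 'a set \<Rightarrow> ('a, 'a set) module"
  where "quot_module R I =
    \<lparr>carrier = carrier (R Quot I), mult = mult (R Quot I), one = one (R Quot I),
     zero = zero (R Quot I), add = add (R Quot I),
     smult = (\<lambda>r X. (I +>\<^bsub>R\<^esub> r) \<otimes>\<^bsub>R Quot I\<^esub> X)\<rparr>"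

(* Homomorphisms are taken extensional, so that equality of elements of Hom(M, N) is equality
   of maps on the carrier of M. *)
definition Hom_module ::
    "('a, 'e) ring_scheme \<Rightarrow> ('a, 'm) module \<Rightarrow> ('a, 'n) module \<Rightarrow> ('a, 'm \<Rightarrow> 'n) module"
  where "Hom_module R M N =
    \<lparr>carrier = mod_hom R M N \<inter> extensional (carrier M),
     mult = undefined, one = undefined,
     zero = (\<lambda>x\<in>carrier M. \<zero>\<^bsub>N\<^esub>),
     add = (\<lambda>f g. \<lambda>x\<in>carrier M. f x \<oplus>\<^bsub>N\<^esub> g x),
     smult = (\<lambda>r f. \<lambda>x\<in>carrier M. r \<odot>\<^bsub>N\<^esub> f x)\<rparr>"

definition fin_gen_ideal :: "('a, 'e) ring_scheme \<Rightarrow> 'a set \<Rightarrow> bool"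
  where "fin_gen_ideal R J \<longleftrightarrow> (\<exists>A. finite A \<and> A \<subseteq> carrier R \<and> J = Idl\<^bsub>R\<^esub> A)"

definition GV :: "('a, 'e) ring_scheme \<Rightarrow> 'a set set"
  where "GV R =
    {J. ideal J R \<and> fin_gen_ideal R J \<and>
        (\<lambda>r. \<lambda>a\<in>J. r \<otimes>\<^bsub>R\<^esub> a)
          \<in> mod_iso R (regular_module R) (Hom_module R (ideal_module R J) (regular_module R))}"

definition tor_GV :: "('a, 'e) ring_scheme \<Rightarrow> ('a, 'm) module \<Rightarrow> 'm set"
  where "tor_GV R M = {x \<in> carrier M. \<exists>J\<in>GV R. \<forall>a\<in>J. a \<odot>\<^bsub>M\<^esub> x = \<zero>\<^bsub>M\<^esub>}"

definition GV_torsion :: "('a, 'e) ring_scheme \<Rightarrow> ('a, 'm) module set"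
  where "GV_torsion R = {M. module R M \<and> tor_GV R M = carrier M}"

definition GV_torsion_free :: "('a, 'e) ring_scheme \<Rightarrow> ('a, 'm) module set"
  where "GV_torsion_free R = {M. module R M \<and> tor_GV R M = {\<zero>\<^bsub>M\<^esub>}}"

definition tau_w :: "('a, 'e) ring_scheme \<Rightarrow> ('a, 'm) module set \<times> ('a, 'm) module set"
  where "tau_w R = (GV_torsion R, GV_torsion_free R)"

definition short_exact ::
    "('a, 'e) ring_scheme \<Rightarrow> ('a, 'l) module \<Rightarrow> ('l \<Rightarrow> 'm) \<Rightarrow> ('a, 'm) module
       \<Rightarrow> ('m \<Rightarrow> 'n) \<Rightarrow> ('a, 'n) module \<Rightarrow> bool"
  where "short_exact R L f M g N \<longleftrightarrow>
    f \<in> mod_hom R L M \<and> g \<in> mod_hom R M N \<and>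
    inj_on f (carrier L) \<and> f ` carrier L = a_kernel M N g \<and> g ` carrier M = carrier N"

(* Submodules are understood, as usual in the category of modules, up to isomorphism, i.e. as
   sources of injective homomorphisms; the inclusions of actual submodules are a special case. *)
definition closed_under_submodules :: "('a, 'e) ring_scheme \<Rightarrow> ('a, 'm) module set \<Rightarrow> bool"
  where "closed_under_submodules R C \<longleftrightarrow>
    (\<forall>M\<in>C. \<forall>N f. module R N \<and> f \<in> mod_hom R N M \<and> inj_on f (carrier N) \<longrightarrow> N \<in> C)"

definition closed_under_images :: "('a, 'e) ring_scheme \<Rightarrow> ('a, 'm) module set \<Rightarrow> bool"
  where "closed_under_images R C \<longleftrightarrow>
    (\<forall>M\<in>C. \<forall>N f. module R N \<and> f \<in> mod_hom R M N \<and> f ` carrier M = carrier N \<longrightarrow> N \<in> C)"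

(* Torsion theories on the category of R-modules with elements in the type 'm, which is an
   arbitrary universe.  As every quotient and every submodule of such a module has an
   isomorphic copy in 'm, staying inside 'm loses no images or submodules. *)
definition torsion_theory ::
    "('a, 'e) ring_scheme \<Rightarrow> ('a, 'm) module set \<times> ('a, 'm) module set \<Rightarrow> bool"
  where "torsion_theory R \<tau> \<longleftrightarrow> (case \<tau> of (T, F) \<Rightarrow>
    (\<forall>M\<in>T \<union> F. module R M) \<and>
    T \<inter> F = {M. module R M \<and> carrier M = {\<zero>\<^bsub>M\<^esub>}} \<and>
    closed_under_images R T \<and>
    closed_under_submodules R F \<and>
    (\<forall>M :: ('a, 'm) module. module R M \<longrightarrow>
       (\<exists>L\<in>T. \<exists>N\<in>F. \<exists>f g. short_exact R L f M g N)))"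

definition hereditary_torsion_theory ::
    "('a, 'e) ring_scheme \<Rightarrow> ('a, 'm) module set \<times> ('a, 'm) module set \<Rightarrow> bool"
  where "hereditary_torsion_theory R \<tau> \<longleftrightarrow>
    torsion_theory R \<tau> \<and> closed_under_submodules R (fst \<tau>)"

(* The modules R/I live in the universe 'a set, so this is the filter of a torsion theory on
   that universe. *)
definition gabriel_filter ::
    "('a, 'e) ring_scheme \<Rightarrow> ('a, 'a set) module set \<times> ('a, 'a set) module set \<Rightarrow> 'a set set"
  where "gabriel_filter R \<tau> = {I. ideal I R \<and> quot_module R I \<in> fst \<tau>}"

end

theory Submission
  imports Defs
begin

text \<open>
  Everything rests on the fact that GV-ideals are closed under products.  If \<open>J\<close> and \<open>J'\<close> are
  GV-ideals and \<open>f\<close> is a homomorphism from \<open>J J'\<close> to \<open>R\<close>, then for each \<open>a \<in> J\<close> the map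
  \<open>b \<mapsto> f (a b)\<close> on \<open>J'\<close> is multiplication by a unique \<open>r a\<close>; uniqueness makes \<open>a \<mapsto> r a\<close> a
  homomorphism on \<open>J\<close>, so \<open>r a = s a\<close> for some \<open>s\<close>, and \<open>f\<close> is multiplication by \<open>s\<close>
  (\<open>GV_product\<close>).

  Consequently finitely many GV-ideals have a GV-ideal below them, so that \<open>tor_GV R M\<close> is a
  submodule.  Moreover \<open>M / tor_GV R M\<close> is torsion-free: if \<open>J x\<close> consists of torsion elements,
  one GV-ideal \<open>K\<close> kills \<open>a x\<close> for the finitely many generators \<open>a\<close> of \<open>J\<close>, and the
  GV-ideal \<open>J K\<close> kills \<open>x\<close> (\<open>tor_GV_if_GV_multiples\<close>).  This gives the exact sequence of the
  torsion theory.  The closure properties hold because an element that kills \<open>x\<close> kills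
  \<open>f x\<close>, and conversely if \<open>f\<close> is injective.  Finally \<open>R/I\<close> is torsion precisely if the class
  of \<open>1\<close> is killed by some GV-ideal \<open>J\<close>, which means \<open>J \<subseteq> I\<close>.
\<close>

section \<open>GV-ideals\<close>

lemma (in cring) ideal_if_closed:
  assumes "I \<subseteq> carrier R" and "\<zero> \<in> I"
    and add: "\<And>x y. \<lbrakk>x \<in> I; y \<in> I\<rbrakk> \<Longrightarrow> x \<oplus> y \<in> I"
    and mult: "\<And>r x. \<lbrakk>r \<in> carrier R; x \<in> I\<rbrakk> \<Longrightarrow> r \<otimes> x \<in> I"
  shows "ideal I R"
proof (rule idealI)
  show "ring R" by (rule ring_axioms)
  show "subgroup I (add_monoid R)"
  proof (rule add.subgroupI)
    show "I \<subseteq> carrier R" by fact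
    show "I \<noteq> {}" using assms(2) by blast
    show "\<ominus> x \<in> I" if "x \<in> I" for x
    proof -
      have "x \<in> carrier R" using that assms(1) by blast
      then have "\<ominus> x = (\<ominus> \<one>) \<otimes> x" by (simp add: l_minus)
      then show ?thesis using mult[of "\<ominus> \<one>" x] that by simp
    qed
    show "x \<oplus> y \<in> I" if "x \<in> I" "y \<in> I" for x y using add that .
  qed
  show "x \<otimes> a \<in> I" if "a \<in> I" "x \<in> carrier R" for a x using mult that by blast
  show "a \<otimes> x \<in> I" if "a \<in> I" "x \<in> carrier R" for a x
    using mult[OF that(2,1)] that assms(1) m_comm[of a x] by auto
qed

lemma (in cring) eq_if_faithful:
  assumes "S \<subseteq> carrier R"
    and faithful: "\<And>r. \<lbrakk>r \<in> carrier R; \<And>a. a \<in> S \<Longrightarrow> r \<otimes> a = \<zero>\<rbrakk> \<Longrightarrow> r = \<zero>"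
    and rs: "r \<in> carrier R" "s \<in> carrier R"
    and eq: "\<And>a. a \<in> S \<Longrightarrow> r \<otimes> a = s \<otimes> a"
  shows "r = s"
proof -
  have "(r \<ominus> s) \<otimes> a = \<zero>" if "a \<in> S" for a
  proof -
    have "a \<in> carrier R" using that assms(1) by blast
    then show ?thesis using rs eq[OF that] by (simp add: a_minus_def l_distr l_minus r_neg)
  qed
  then have "r \<ominus> s = \<zero>" using faithful rs by simp
  moreover have "r = (r \<ominus> s) \<oplus> s" using rs by (simp add: a_minus_def a_assoc l_neg)
  ultimately show ?thesis using rs by simp
qed

text \<open>Unfolds the bundled isomorphism: injectivity of \<open>R \<rightarrow> Hom(J, R)\<close> says that no nonzero element
  annihilates \<open>J\<close>, surjectivity that every homomorphism is a multiplication.\<close>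

lemma (in cring) GV_iff:
  "J \<in> GV R \<longleftrightarrow> ideal J R \<and> fin_gen_ideal R J \<and>
     (\<forall>r\<in>carrier R. (\<forall>a\<in>J. r \<otimes> a = \<zero>) \<longrightarrow> r = \<zero>) \<and>
     (\<forall>f. f \<in> J \<rightarrow> carrier R \<and> (\<forall>a\<in>J. \<forall>b\<in>J. f (a \<oplus> b) = f a \<oplus> f b) \<and>
          (\<forall>r\<in>carrier R. \<forall>a\<in>J. f (r \<otimes> a) = r \<otimes> f a)
        \<longrightarrow> (\<exists>r\<in>carrier R. \<forall>a\<in>J. f a = r \<otimes> a))"
  (is "_ \<longleftrightarrow> _ \<and> _ \<and> ?faithful \<and> ?multiplication")
proof (cases "ideal J R")
  case True
  interpret J: ideal J R by fact
  let ?H = "Hom_module R (ideal_module R J) (regular_module R)"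
  let ?\<mu> = "\<lambda>r. \<lambda>a\<in>J. r \<otimes> a"
  have car: "carrier ?H = {f. f \<in> J \<rightarrow> carrier R \<and> (\<forall>a\<in>J. \<forall>b\<in>J. f (a \<oplus> b) = f a \<oplus> f b) \<and>
      (\<forall>r\<in>carrier R. \<forall>a\<in>J. f (r \<otimes> a) = r \<otimes> f a) \<and> f \<in> extensional J}"
    by (auto simp: Hom_module_def mod_hom_def hom_def ideal_module_def regular_module_def)
  have \<mu>_in: "?\<mu> r \<in> carrier ?H" if "r \<in> carrier R" for r
    using that J.Icarr J.I_l_closed J.a_closed
    by (auto simp: car r_distr m_lcomm)
  have hom: "?\<mu> \<in> mod_hom R (regular_module R) ?H"
  proof -
    have "?\<mu> \<in> carrier R \<rightarrow> carrier ?H" using \<mu>_in by blast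
    moreover have "?\<mu> (r \<oplus> s) = add ?H (?\<mu> r) (?\<mu> s)" if "r \<in> carrier R" "s \<in> carrier R" for r s
      using that J.Icarr
      by (auto simp: Hom_module_def ideal_module_def regular_module_def l_distr restrict_def fun_eq_iff)
    moreover have "?\<mu> (r \<otimes> s) = smult ?H r (?\<mu> s)" if "r \<in> carrier R" "s \<in> carrier R" for r s
      using that J.Icarr
      by (auto simp: Hom_module_def ideal_module_def regular_module_def m_assoc restrict_def fun_eq_iff)
    ultimately show ?thesis
      by (simp add: mod_hom_def hom_def regular_module_def)
  qed
  have inj: "inj_on ?\<mu> (carrier R) \<longleftrightarrow> ?faithful"
  proof
    assume inj: "inj_on ?\<mu> (carrier R)"
    show ?faithful
    proof (intro ballI impI)
      fix r assume r: "r \<in> carrier R" "\<forall>a\<in>J. r \<otimes> a = \<zero>"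
      then have "?\<mu> r = ?\<mu> \<zero>" using J.Icarr by (auto simp: restrict_def fun_eq_iff)
      then show "r = \<zero>" using inj r(1) by (meson inj_onD zero_closed)
    qed
  next
    assume faithful: ?faithful
    show "inj_on ?\<mu> (carrier R)"
    proof (rule inj_onI)
      fix r s assume rs: "r \<in> carrier R" "s \<in> carrier R" and eq: "?\<mu> r = ?\<mu> s"
      show "r = s"
      proof (rule eq_if_faithful)
        show "J \<subseteq> carrier R" using J.Icarr by blast
        show "t = \<zero>" if "t \<in> carrier R" "\<And>a. a \<in> J \<Longrightarrow> t \<otimes> a = \<zero>" for t
          using faithful that by blast
        show "r \<otimes> a = s \<otimes> a" if "a \<in> J" for a using fun_cong[OF eq, of a] that by simp
      qed fact+
    qed
  qed
  have surj: "?\<mu> ` carrier R = carrier ?H \<longleftrightarrow> ?multiplication"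
  proof
    assume im: "?\<mu> ` carrier R = carrier ?H"
    show ?multiplication
    proof (intro allI impI)
      fix f assume f: "f \<in> J \<rightarrow> carrier R \<and> (\<forall>a\<in>J. \<forall>b\<in>J. f (a \<oplus> b) = f a \<oplus> f b) \<and>
          (\<forall>r\<in>carrier R. \<forall>a\<in>J. f (r \<otimes> a) = r \<otimes> f a)"
      then have "restrict f J \<in> carrier ?H"
        using J.I_l_closed J.a_closed by (auto simp: car)
      then obtain r where "r \<in> carrier R" "restrict f J = ?\<mu> r" using im by blast
      then show "\<exists>r\<in>carrier R. \<forall>a\<in>J. f a = r \<otimes> a" by (metis restrict_apply')
    qed
  next
    assume mult: ?multiplication
    have "f \<in> ?\<mu> ` carrier R" if f: "f \<in> carrier ?H" for f
    proof -
      have "f \<in> J \<rightarrow> carrier R \<and> (\<forall>a\<in>J. \<forall>b\<in>J. f (a \<oplus> b) = f a \<oplus> f b) \<and>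
          (\<forall>r\<in>carrier R. \<forall>a\<in>J. f (r \<otimes> a) = r \<otimes> f a)"
        using f unfolding car by blast
      from mult[THEN spec, THEN mp, OF this]
      obtain r where r: "r \<in> carrier R" "\<forall>a\<in>J. f a = r \<otimes> a" by blast
      have "f = ?\<mu> r"
      proof (rule extensionalityI[where A = J])
        show "f \<in> extensional J" using f unfolding car by blast
      qed (use r(2) in simp_all)
      then show ?thesis using r(1) by blast
    qed
    then show "?\<mu> ` carrier R = carrier ?H" using \<mu>_in by (intro equalityI subsetI) auto
  qed
  have "carrier (regular_module R) = carrier R" by (simp add: regular_module_def)
  then have "?\<mu> \<in> mod_iso R (regular_module R) ?H \<longleftrightarrow>
      inj_on ?\<mu> (carrier R) \<and> ?\<mu> ` carrier R = carrier ?H"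
    using hom unfolding mod_iso_def bij_betw_def by auto
  also have "\<dots> \<longleftrightarrow> ?faithful \<and> ?multiplication" by (simp only: inj surj)
  finally show ?thesis using True unfolding GV_def mem_Collect_eq by blast
qed (simp add: GV_def)

lemma (in cring) GV_ideal: "J \<in> GV R \<Longrightarrow> ideal J R"
  by (simp add: GV_def)

lemma (in cring) GV_faithful:
  assumes "J \<in> GV R" and "r \<in> carrier R" and "\<And>a. a \<in> J \<Longrightarrow> r \<otimes> a = \<zero>"
  shows "r = \<zero>"
  using assms(1)[unfolded GV_iff, THEN conjunct2, THEN conjunct2, THEN conjunct1, THEN bspec,
      OF assms(2)] assms(3) by blast

lemma (in cring) GV_multiplication:
  assumes "J \<in> GV R" and "\<And>a. a \<in> J \<Longrightarrow> f a \<in> carrier R"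
    and "\<And>a b. \<lbrakk>a \<in> J; b \<in> J\<rbrakk> \<Longrightarrow> f (a \<oplus> b) = f a \<oplus> f b"
    and "\<And>r a. \<lbrakk>r \<in> carrier R; a \<in> J\<rbrakk> \<Longrightarrow> f (r \<otimes> a) = r \<otimes> f a"
  shows "\<exists>r\<in>carrier R. \<forall>a\<in>J. f a = r \<otimes> a"
  by (rule assms(1)[unfolded GV_iff, THEN conjunct2, THEN conjunct2, THEN conjunct2, THEN spec,
      THEN mp]) (use assms(2-4) in blast)

lemma (in cring) GV_carrier: "carrier R \<in> GV R"
  unfolding GV_iff
proof (intro conjI ballI allI impI)
  show "ideal (carrier R) R" by (rule oneideal)
  show "fin_gen_ideal R (carrier R)"
    unfolding fin_gen_ideal_def using genideal_one by (intro exI[of _ "{\<one>}"]) simp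
  show "r = \<zero>" if "r \<in> carrier R" "\<forall>a\<in>carrier R. r \<otimes> a = \<zero>" for r
    using that by (metis one_closed r_one)
  show "\<exists>r\<in>carrier R. \<forall>a\<in>carrier R. f a = r \<otimes> a"
    if f: "f \<in> carrier R \<rightarrow> carrier R \<and>
      (\<forall>a\<in>carrier R. \<forall>b\<in>carrier R. f (a \<oplus> b) = f a \<oplus> f b) \<and>
      (\<forall>r\<in>carrier R. \<forall>a\<in>carrier R. f (r \<otimes> a) = r \<otimes> f a)" for f
  proof (intro bexI ballI)
    show "f \<one> \<in> carrier R" using f by blast
    fix a assume a: "a \<in> carrier R"
    then have "f (a \<otimes> \<one>) = a \<otimes> f \<one>" using f by blast
    then show "f a = f \<one> \<otimes> a" using a f m_comm[of a "f \<one>"] by auto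
  qed
qed

lemma (in cring) ideal_multiplier:
  assumes "ideal K R" and "y \<in> carrier R"
  shows "ideal {x \<in> carrier R. x \<otimes> y \<in> K} R"
proof -
  interpret K: ideal K R by fact
  show ?thesis
    by (rule ideal_if_closed)
      (use assms(2) K.a_closed K.I_l_closed in \<open>auto simp: l_distr m_assoc\<close>)
qed

text \<open>\<open>K\<close> is the product ideal \<open>J J'\<close>, characterised as the least ideal containing all products.
  It is generated by the products of generators; that these suffice is seen by fixing one factor
  at a time, since the multipliers of an element into \<open>K\<close> form an ideal.\<close>

lemma (in cring) fin_gen_ideal_product:
  assumes "fin_gen_ideal R J" and "fin_gen_ideal R J'"
  obtains K where "ideal K R" and "fin_gen_ideal R K" and "K \<subseteq> J" and "K \<subseteq> J'"
    and "\<forall>a\<in>J. \<forall>b\<in>J'. a \<otimes> b \<in> K"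
    and "\<forall>L. ideal L R \<longrightarrow> (\<forall>a\<in>J. \<forall>b\<in>J'. a \<otimes> b \<in> L) \<longrightarrow> K \<subseteq> L"
proof -
  obtain A B where A: "finite A" "A \<subseteq> carrier R" "J = Idl A"
    and B: "finite B" "B \<subseteq> carrier R" "J' = Idl B"
    using assms unfolding fin_gen_ideal_def by blast
  interpret J: ideal J R using A genideal_ideal by blast
  interpret J': ideal J' R using B genideal_ideal by blast
  define S where "S = (\<lambda>(a, b). a \<otimes> b) ` (A \<times> B)"
  have S: "finite S" "S \<subseteq> carrier R" using A B by (auto simp: S_def)
  have AJ: "A \<subseteq> J" and BJ': "B \<subseteq> J'"
    unfolding A(3) B(3) by (rule genideal_self, fact)+
  have K: "ideal (Idl S) R" using S genideal_ideal by blast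
  have "S \<subseteq> Idl S" using S(2) by (rule genideal_self)
  then have gen: "a \<otimes> b \<in> Idl S" if "a \<in> A" "b \<in> B" for a b
    using that unfolding S_def by blast
  have left: "a \<otimes> b \<in> Idl S" if a: "a \<in> J" and b: "b \<in> B" for a b
  proof -
    have "Idl A \<subseteq> {x \<in> carrier R. x \<otimes> b \<in> Idl S}"
      by (rule genideal_minimal[OF ideal_multiplier[OF K]]) (use A(2) B(2) b gen in auto)
    then show ?thesis using a A(3) by blast
  qed
  have prod: "a \<otimes> b \<in> Idl S" if a: "a \<in> J" and b: "b \<in> J'" for a b
  proof -
    have ac: "a \<in> carrier R" using a by (rule J.Icarr)
    have "x \<otimes> a \<in> Idl S" if "x \<in> B" for x
      using left[OF a that] m_comm[of x a] ac that B(2) by auto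
    then have "Idl B \<subseteq> {x \<in> carrier R. x \<otimes> a \<in> Idl S}"
      by (intro genideal_minimal[OF ideal_multiplier[OF K ac]]) (use B(2) in auto)
    then have "b \<otimes> a \<in> Idl S" using b B(3) by blast
    then show ?thesis using m_comm[OF ac J'.Icarr[OF b]] by simp
  qed
  show thesis
  proof (rule that[of "Idl S"])
    show "fin_gen_ideal R (Idl S)" unfolding fin_gen_ideal_def using S by blast
    show "Idl S \<subseteq> J"
      by (rule genideal_minimal[OF J.is_ideal]) (use AJ B(2) J.I_r_closed in \<open>auto simp: S_def\<close>)
    show "Idl S \<subseteq> J'"
      by (rule genideal_minimal[OF J'.is_ideal]) (use BJ' A(2) J'.I_l_closed in \<open>auto simp: S_def\<close>)
    show "\<forall>a\<in>J. \<forall>b\<in>J'. a \<otimes> b \<in> Idl S" using prod by blast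
    show "\<forall>L. ideal L R \<longrightarrow> (\<forall>a\<in>J. \<forall>b\<in>J'. a \<otimes> b \<in> L) \<longrightarrow> Idl S \<subseteq> L"
    proof (intro allI impI)
      fix L assume "ideal L R" and L: "\<forall>a\<in>J. \<forall>b\<in>J'. a \<otimes> b \<in> L"
      have "a \<otimes> b \<in> L" if "a \<in> A" "b \<in> B" for a b using that AJ BJ' L by blast
      then have "S \<subseteq> L" by (auto simp: S_def)
      with \<open>ideal L R\<close> show "Idl S \<subseteq> L" by (rule genideal_minimal)
    qed
  qed (rule K)
qed

text \<open>Closure of GV-ideals under products.  The minimality of \<open>K\<close> reduces both the identity
  \<open>f k = s k\<close> on \<open>K\<close> and, later, the vanishing of \<open>K x\<close> to products \<open>a b\<close>.\<close>

lemma (in cring) GV_product: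
  assumes J: "J \<in> GV R" and J': "J' \<in> GV R"
  obtains K where "K \<in> GV R" and "K \<subseteq> J" and "K \<subseteq> J'"
    and "\<forall>L. ideal L R \<longrightarrow> (\<forall>a\<in>J. \<forall>b\<in>J'. a \<otimes> b \<in> L) \<longrightarrow> K \<subseteq> L"
proof -
  interpret J: ideal J R using J by (rule GV_ideal)
  interpret J': ideal J' R using J' by (rule GV_ideal)
  have fin_gen: "fin_gen_ideal R J" "fin_gen_ideal R J'" using J J' unfolding GV_def by blast+
  obtain K where K: "ideal K R" "fin_gen_ideal R K" "K \<subseteq> J" "K \<subseteq> J'"
    and prod': "\<forall>a\<in>J. \<forall>b\<in>J'. a \<otimes> b \<in> K"
    and least: "\<forall>L. ideal L R \<longrightarrow> (\<forall>a\<in>J. \<forall>b\<in>J'. a \<otimes> b \<in> L) \<longrightarrow> K \<subseteq> L"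
    by (rule fin_gen_ideal_product[OF fin_gen])
  have prod: "a \<otimes> b \<in> K" if "a \<in> J" "b \<in> J'" for a b using prod' that by blast
  interpret K: ideal K R by fact
  note faith = GV_faithful[OF J] and faith' = GV_faithful[OF J']
  have cancel': "r = s"
    if "r \<in> carrier R" "s \<in> carrier R" "\<And>b. b \<in> J' \<Longrightarrow> r \<otimes> b = s \<otimes> b" for r s
  proof (rule eq_if_faithful)
    show "J' \<subseteq> carrier R" using J'.Icarr by blast
  qed (fact faith' that)+
  have "K \<in> GV R"
    unfolding GV_iff
  proof (intro conjI ballI allI impI)
    fix r assume r: "r \<in> carrier R" "\<forall>k\<in>K. r \<otimes> k = \<zero>"
    show "r = \<zero>"
    proof (rule faith)
      fix a assume a: "a \<in> J"
      show "r \<otimes> a = \<zero>"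
      proof (rule faith')
        show "(r \<otimes> a) \<otimes> b = \<zero>" if "b \<in> J'" for b
          using r prod[OF a that] J.Icarr[OF a] J'.Icarr[OF that] by (simp add: m_assoc)
      qed (use r J.Icarr[OF a] in simp)
    qed fact
  next
    fix f assume "f \<in> K \<rightarrow> carrier R \<and> (\<forall>a\<in>K. \<forall>b\<in>K. f (a \<oplus> b) = f a \<oplus> f b) \<and>
      (\<forall>r\<in>carrier R. \<forall>a\<in>K. f (r \<otimes> a) = r \<otimes> f a)"
    then have f_in: "\<And>k. k \<in> K \<Longrightarrow> f k \<in> carrier R"
      and f_add: "\<And>a b. a \<in> K \<Longrightarrow> b \<in> K \<Longrightarrow> f (a \<oplus> b) = f a \<oplus> f b"
      and f_mult: "\<And>r a. r \<in> carrier R \<Longrightarrow> a \<in> K \<Longrightarrow> f (r \<otimes> a) = r \<otimes> f a"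
      by auto
    have "\<exists>r. r \<in> carrier R \<and> (\<forall>b\<in>J'. f (a \<otimes> b) = r \<otimes> b)" if a: "a \<in> J" for a
    proof -
      have ac: "a \<in> carrier R" using a by (rule J.Icarr)
      have "(\<lambda>b. f (a \<otimes> b)) \<in> J' \<rightarrow> carrier R" using prod[OF a] f_in by blast
      moreover have "f (a \<otimes> (b \<oplus> c)) = f (a \<otimes> b) \<oplus> f (a \<otimes> c)" if "b \<in> J'" "c \<in> J'" for b c
        using that prod[OF a] ac J'.Icarr by (simp add: r_distr f_add)
      moreover have "f (a \<otimes> (r \<otimes> b)) = r \<otimes> f (a \<otimes> b)" if "r \<in> carrier R" "b \<in> J'" for r b
        using that prod[OF a] ac J'.Icarr m_lcomm[of a r b] by (simp add: f_mult)
      ultimately have "\<exists>r\<in>carrier R. \<forall>b\<in>J'. f (a \<otimes> b) = r \<otimes> b"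
        by (intro GV_multiplication[OF J']) auto
      then show ?thesis by blast
    qed
    then obtain r where r_in: "\<And>a. a \<in> J \<Longrightarrow> r a \<in> carrier R"
      and r: "\<And>a b. a \<in> J \<Longrightarrow> b \<in> J' \<Longrightarrow> f (a \<otimes> b) = r a \<otimes> b"
      by metis
    \<comment> \<open>The multiplier \<open>r a\<close> is unique, hence depends linearly on \<open>a\<close>.\<close>
    have r_add: "r (a \<oplus> c) = r a \<oplus> r c" if a: "a \<in> J" and c: "c \<in> J" for a c
    proof (rule cancel')
      show "r (a \<oplus> c) \<otimes> b = (r a \<oplus> r c) \<otimes> b" if b: "b \<in> J'" for b
      proof -
        have "r (a \<oplus> c) \<otimes> b = f ((a \<oplus> c) \<otimes> b)" using a c b r J.a_closed by simp
        also have "\<dots> = f (a \<otimes> b) \<oplus> f (c \<otimes> b)"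
          using a b c prod J.Icarr J'.Icarr by (simp add: l_distr f_add)
        also have "\<dots> = (r a \<oplus> r c) \<otimes> b"
          using a b c r r_in J'.Icarr by (simp add: l_distr)
        finally show ?thesis .
      qed
    qed (use a c r_in J.a_closed in auto)
    have r_mult: "r (t \<otimes> a) = t \<otimes> r a" if t: "t \<in> carrier R" and a: "a \<in> J" for t a
    proof (rule cancel')
      show "r (t \<otimes> a) \<otimes> b = (t \<otimes> r a) \<otimes> b" if b: "b \<in> J'" for b
      proof -
        have "r (t \<otimes> a) \<otimes> b = f ((t \<otimes> a) \<otimes> b)" using a t b r J.I_l_closed by simp
        also have "\<dots> = t \<otimes> f (a \<otimes> b)"
          using a b t prod J.Icarr J'.Icarr by (simp add: m_assoc f_mult)
        also have "\<dots> = (t \<otimes> r a) \<otimes> b"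
          using a b t r r_in J'.Icarr by (simp add: m_assoc)
        finally show ?thesis .
      qed
    qed (use a t r_in J.I_l_closed in auto)
    obtain s where s: "s \<in> carrier R" "\<And>a. a \<in> J \<Longrightarrow> r a = s \<otimes> a"
      using GV_multiplication[OF J r_in r_add r_mult] by blast
    have f_zero: "f \<zero> = \<zero>"
      using f_mult[OF zero_closed additive_subgroup.zero_closed[OF K.additive_subgroup_axioms]]
        f_in additive_subgroup.zero_closed[OF K.additive_subgroup_axioms] by simp
    have "K \<subseteq> {k \<in> K. f k = s \<otimes> k}"
    proof (rule least[rule_format])
      show "ideal {k \<in> K. f k = s \<otimes> k} R"
        by (rule ideal_if_closed)
          (use s(1) K.Icarr K.a_closed K.I_l_closed f_zero
            additive_subgroup.zero_closed[OF K.additive_subgroup_axioms]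
            in \<open>auto simp: f_add f_mult r_distr m_lcomm\<close>)
      show "a \<otimes> b \<in> {k \<in> K. f k = s \<otimes> k}" if "a \<in> J" "b \<in> J'" for a b
        using that prod r s J.Icarr J'.Icarr by (simp add: m_assoc)
    qed
    then show "\<exists>r\<in>carrier R. \<forall>a\<in>K. f a = r \<otimes> a" using s(1) by blast
  qed (use K in auto)
  then show thesis using K(3,4) least by (rule that)
qed

lemma (in cring) GV_lower_bound:
  assumes "finite \<J>" and "\<J> \<subseteq> GV R"
  shows "\<exists>K\<in>GV R. \<forall>J\<in>\<J>. K \<subseteq> J"
  using assms
proof (induction \<J>)
  case empty
  show ?case using GV_carrier by blast
next
  case (insert J \<J>)
  from insert.IH obtain K where "K \<in> GV R" and K: "\<forall>J\<in>\<J>. K \<subseteq> J"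
    using insert.prems by (elim meta_impE bexE) simp_all
  have "J \<in> GV R" using insert.prems by simp
  then obtain K' where "K' \<in> GV R" "K' \<subseteq> J" "K' \<subseteq> K"
    using \<open>K \<in> GV R\<close> by (rule GV_product) (rule that)
  then have "\<forall>I\<in>insert J \<J>. K' \<subseteq> I" using K by auto
  then show ?case using \<open>K' \<in> GV R\<close> by (rule bexI)
qed

section \<open>The torsion submodule\<close>

lemma (in module) ideal_annihilator:
  assumes "x \<in> carrier M"
  shows "ideal {a \<in> carrier R. a \<odot>\<^bsub>M\<^esub> x = \<zero>\<^bsub>M\<^esub>} R"
  by (rule ideal_if_closed) (use assms in \<open>auto simp: smult_l_distr smult_assoc1\<close>)

lemma tor_GV_I:
  "\<lbrakk>x \<in> carrier M; J \<in> GV R; \<And>a. a \<in> J \<Longrightarrow> a \<odot>\<^bsub>M\<^esub> x = \<zero>\<^bsub>M\<^esub>\<rbrakk> \<Longrightarrow> x \<in> tor_GV R M"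
  by (auto simp: tor_GV_def)

lemma tor_GV_E:
  assumes "x \<in> tor_GV R M"
  obtains J where "x \<in> carrier M" and "J \<in> GV R" and "\<And>a. a \<in> J \<Longrightarrow> a \<odot>\<^bsub>M\<^esub> x = \<zero>\<^bsub>M\<^esub>"
  using assms by (auto simp: tor_GV_def)

lemma tor_GV_subset: "tor_GV R M \<subseteq> carrier M"
  by (auto simp: tor_GV_def)

lemma zero_in_tor_GV:
  fixes M :: "('a, 'm) module"
  assumes "module R M"
  shows "\<zero>\<^bsub>M\<^esub> \<in> tor_GV R M"
proof -
  interpret module R M by fact
  show ?thesis by (rule tor_GV_I[OF _ GV_carrier]) auto
qed

lemma submodule_tor_GV:
  fixes M :: "('a, 'm) module"
  assumes "module R M"
  shows "submodule (tor_GV R M) R M"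
proof -
  interpret module R M by fact
  show ?thesis
  proof (rule submoduleI)
    show "tor_GV R M \<subseteq> carrier M" by (rule tor_GV_subset)
    show "\<zero>\<^bsub>M\<^esub> \<in> tor_GV R M" using assms by (rule zero_in_tor_GV)
    have smult: "r \<odot>\<^bsub>M\<^esub> x \<in> tor_GV R M" if r: "r \<in> carrier R" and x: "x \<in> tor_GV R M" for r x
    proof -
      obtain J where J: "x \<in> carrier M" "J \<in> GV R" "\<And>a. a \<in> J \<Longrightarrow> a \<odot>\<^bsub>M\<^esub> x = \<zero>\<^bsub>M\<^esub>"
        using x by (rule tor_GV_E) blast
      show ?thesis
      proof (rule tor_GV_I[OF _ J(2)])
        fix a assume a: "a \<in> J"
        then have "a \<in> carrier R" using GV_ideal[OF J(2)] by (rule ideal.Icarr[rotated])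
        then have "a \<odot>\<^bsub>M\<^esub> (r \<odot>\<^bsub>M\<^esub> x) = r \<odot>\<^bsub>M\<^esub> (a \<odot>\<^bsub>M\<^esub> x)"
          using r J(1) m_comm[of a r] by (simp flip: smult_assoc1)
        then show "a \<odot>\<^bsub>M\<^esub> (r \<odot>\<^bsub>M\<^esub> x) = \<zero>\<^bsub>M\<^esub>" using J(3)[OF a] r by simp
      qed (use r J in simp)
    qed
    then show "r \<odot>\<^bsub>M\<^esub> x \<in> tor_GV R M" if "r \<in> carrier R" "x \<in> tor_GV R M" for r x
      using that by blast
    show "\<ominus>\<^bsub>M\<^esub> x \<in> tor_GV R M" if x: "x \<in> tor_GV R M" for x
    proof -
      have "x \<in> carrier M" using x by (auto simp: tor_GV_def)
      then have "\<ominus>\<^bsub>M\<^esub> x = (\<ominus>\<^bsub>R\<^esub> \<one>\<^bsub>R\<^esub>) \<odot>\<^bsub>M\<^esub> x" by (simp add: smult_l_minus)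
      then show ?thesis using smult[OF _ x, of "\<ominus>\<^bsub>R\<^esub> \<one>\<^bsub>R\<^esub>"] by simp
    qed
    show "x \<oplus>\<^bsub>M\<^esub> y \<in> tor_GV R M" if x: "x \<in> tor_GV R M" and y: "y \<in> tor_GV R M" for x y
    proof -
      obtain J where J: "x \<in> carrier M" "J \<in> GV R" "\<And>a. a \<in> J \<Longrightarrow> a \<odot>\<^bsub>M\<^esub> x = \<zero>\<^bsub>M\<^esub>"
        using x by (rule tor_GV_E) blast
      obtain J' where J': "y \<in> carrier M" "J' \<in> GV R" "\<And>a. a \<in> J' \<Longrightarrow> a \<odot>\<^bsub>M\<^esub> y = \<zero>\<^bsub>M\<^esub>"
        using y by (rule tor_GV_E) blast
      obtain K where K: "K \<in> GV R" "K \<subseteq> J" "K \<subseteq> J'"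
        using J(2) J'(2) by (rule GV_product) (rule that)
      show ?thesis
      proof (rule tor_GV_I[OF _ K(1)])
        fix a assume a: "a \<in> K"
        then have "a \<in> carrier R" using GV_ideal[OF K(1)] by (rule ideal.Icarr[rotated])
        then show "a \<odot>\<^bsub>M\<^esub> (x \<oplus>\<^bsub>M\<^esub> y) = \<zero>\<^bsub>M\<^esub>"
          using a K J J' by (simp add: smult_r_distr subset_iff)
      qed (use J J' in simp)
    qed
  qed
qed

text \<open>This is where finite generation of GV-ideals enters: a single GV-ideal \<open>K\<close> kills \<open>a x\<close>
  for all generators \<open>a\<close> of \<open>J\<close>, hence \<open>J K\<close> kills \<open>x\<close>.\<close>

lemma tor_GV_if_GV_multiples:
  fixes M :: "('a, 'm) module"
  assumes "module R M" and x: "x \<in> carrier M" and J: "J \<in> GV R"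
    and tor: "\<And>a. a \<in> J \<Longrightarrow> a \<odot>\<^bsub>M\<^esub> x \<in> tor_GV R M"
  shows "x \<in> tor_GV R M"
proof -
  interpret module R M by fact
  obtain A where A: "finite A" "A \<subseteq> carrier R" "J = Idl\<^bsub>R\<^esub> A"
    using J unfolding GV_def fin_gen_ideal_def by blast
  have "\<exists>L. L \<in> GV R \<and> (\<forall>k\<in>L. k \<odot>\<^bsub>M\<^esub> (a \<odot>\<^bsub>M\<^esub> x) = \<zero>\<^bsub>M\<^esub>)" if "a \<in> A" for a
    using tor[of a] that A genideal_self by (auto simp: tor_GV_def)
  then obtain L where L: "\<And>a. a \<in> A \<Longrightarrow> L a \<in> GV R"
    and L0: "\<And>a k. a \<in> A \<Longrightarrow> k \<in> L a \<Longrightarrow> k \<odot>\<^bsub>M\<^esub> (a \<odot>\<^bsub>M\<^esub> x) = \<zero>\<^bsub>M\<^esub>"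
    by metis
  obtain K where K: "K \<in> GV R" "\<forall>I\<in>L ` A. K \<subseteq> I"
    using GV_lower_bound[of "L ` A"] A(1) L by blast
  interpret K: ideal K R using K(1) by (rule GV_ideal)
  interpret J: ideal J R using J by (rule GV_ideal)
  have kill: "(a \<otimes>\<^bsub>R\<^esub> k) \<odot>\<^bsub>M\<^esub> x = \<zero>\<^bsub>M\<^esub>" if a: "a \<in> J" and k: "k \<in> K" for a k
  proof -
    have kc: "k \<in> carrier R" using k by (rule K.Icarr)
    have "a \<odot>\<^bsub>M\<^esub> (k \<odot>\<^bsub>M\<^esub> x) = \<zero>\<^bsub>M\<^esub>" if "a \<in> A" for a
    proof -
      have ac: "a \<in> carrier R" using that A by blast
      have "a \<odot>\<^bsub>M\<^esub> (k \<odot>\<^bsub>M\<^esub> x) = k \<odot>\<^bsub>M\<^esub> (a \<odot>\<^bsub>M\<^esub> x)"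
        using ac kc x m_comm[of a k] by (simp flip: smult_assoc1)
      then show ?thesis using L0 K(2) that k by auto
    qed
    then have "Idl\<^bsub>R\<^esub> A \<subseteq> {a \<in> carrier R. a \<odot>\<^bsub>M\<^esub> (k \<odot>\<^bsub>M\<^esub> x) = \<zero>\<^bsub>M\<^esub>}"
      using A kc x by (intro genideal_minimal ideal_annihilator) auto
    then show ?thesis using a A(3) kc x by (auto simp: smult_assoc1)
  qed
  obtain P where P: "P \<in> GV R"
    and least: "\<forall>L. ideal L R \<longrightarrow> (\<forall>a\<in>J. \<forall>b\<in>K. a \<otimes>\<^bsub>R\<^esub> b \<in> L) \<longrightarrow> P \<subseteq> L"
    using J K(1) by (rule GV_product) (rule that)
  have "P \<subseteq> {a \<in> carrier R. a \<odot>\<^bsub>M\<^esub> x = \<zero>\<^bsub>M\<^esub>}"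
    using kill J.Icarr K.Icarr by (intro least[rule_format] ideal_annihilator x) auto
  then show ?thesis by (intro tor_GV_I[OF x P]) auto
qed

section \<open>Closure properties\<close>

lemma mod_homD:
  assumes "f \<in> mod_hom R M N"
  shows "x \<in> carrier M \<Longrightarrow> f x \<in> carrier N"
    and "\<lbrakk>x \<in> carrier M; y \<in> carrier M\<rbrakk> \<Longrightarrow> f (x \<oplus>\<^bsub>M\<^esub> y) = f x \<oplus>\<^bsub>N\<^esub> f y"
    and "\<lbrakk>r \<in> carrier R; x \<in> carrier M\<rbrakk> \<Longrightarrow> f (r \<odot>\<^bsub>M\<^esub> x) = r \<odot>\<^bsub>N\<^esub> f x"
  using assms by (auto simp: mod_hom_def hom_def)

lemma mod_hom_zero:
  assumes "module R M" and "module R N" and f: "f \<in> mod_hom R M N"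
  shows "f \<zero>\<^bsub>M\<^esub> = \<zero>\<^bsub>N\<^esub>"
proof -
  interpret M: module R M by fact
  interpret N: module R N by fact
  have "f (\<zero>\<^bsub>R\<^esub> \<odot>\<^bsub>M\<^esub> \<zero>\<^bsub>M\<^esub>) = \<zero>\<^bsub>R\<^esub> \<odot>\<^bsub>N\<^esub> f \<zero>\<^bsub>M\<^esub>" using f by (intro mod_homD(3)) auto
  then show ?thesis using mod_homD(1)[OF f, of "\<zero>\<^bsub>M\<^esub>"] by simp
qed

lemma tor_GV_hom:
  assumes "module R M" and "module R N" and f: "f \<in> mod_hom R M N" and x: "x \<in> tor_GV R M"
  shows "f x \<in> tor_GV R N"
proof -
  interpret M: module R M by fact
  obtain J where J: "x \<in> carrier M" "J \<in> GV R" "\<And>a. a \<in> J \<Longrightarrow> a \<odot>\<^bsub>M\<^esub> x = \<zero>\<^bsub>M\<^esub>"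
    using x by (rule tor_GV_E) blast
  show ?thesis
  proof (rule tor_GV_I[OF mod_homD(1)[OF f J(1)] J(2)])
    fix a assume a: "a \<in> J"
    then have "a \<in> carrier R" using M.GV_ideal[OF J(2)] by (rule ideal.Icarr[rotated])
    then show "a \<odot>\<^bsub>N\<^esub> f x = \<zero>\<^bsub>N\<^esub>"
      using mod_homD(3)[OF f _ J(1)] J(3)[OF a] mod_hom_zero[OF assms(1-3)] by metis
  qed
qed

lemma tor_GV_hom_inj:
  assumes "module R M" and "module R N" and f: "f \<in> mod_hom R M N"
    and inj: "inj_on f (carrier M)" and x: "x \<in> carrier M" and fx: "f x \<in> tor_GV R N"
  shows "x \<in> tor_GV R M"
proof -
  interpret M: module R M by fact
  obtain J where J: "J \<in> GV R" "\<And>a. a \<in> J \<Longrightarrow> a \<odot>\<^bsub>N\<^esub> f x = \<zero>\<^bsub>N\<^esub>"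
    using fx by (rule tor_GV_E) blast
  show ?thesis
  proof (rule tor_GV_I[OF x J(1)])
    fix a assume a: "a \<in> J"
    then have ac: "a \<in> carrier R" using M.GV_ideal[OF J(1)] by (rule ideal.Icarr[rotated])
    then have "f (a \<odot>\<^bsub>M\<^esub> x) = f \<zero>\<^bsub>M\<^esub>"
      using mod_homD(3)[OF f _ x] J(2)[OF a] mod_hom_zero[OF assms(1-3)] by metis
    then show "a \<odot>\<^bsub>M\<^esub> x = \<zero>\<^bsub>M\<^esub>" using inj ac x by (simp add: inj_on_eq_iff)
  qed
qed

lemma GV_torsion_closed_under_images: "closed_under_images R (GV_torsion R)"
proof -
  have "N \<in> GV_torsion R" if "M \<in> GV_torsion R" "module R N" "f \<in> mod_hom R M N"
      "f ` carrier M = carrier N" for M N :: "('a, 'm) module" and f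
  proof -
    have "module R M" "tor_GV R M = carrier M" using that(1) by (auto simp: GV_torsion_def)
    then have "f ` carrier M \<subseteq> tor_GV R N" using tor_GV_hom[OF _ that(2,3)] by blast
    then have "tor_GV R N = carrier N" using that(4) tor_GV_subset[of R N] by simp
    then show ?thesis using that(2) by (simp add: GV_torsion_def)
  qed
  then show ?thesis unfolding closed_under_images_def by blast
qed

lemma GV_torsion_closed_under_submodules: "closed_under_submodules R (GV_torsion R)"
proof -
  have "N \<in> GV_torsion R" if "M \<in> GV_torsion R" "module R N" "f \<in> mod_hom R N M"
      "inj_on f (carrier N)" for M N :: "('a, 'm) module" and f
  proof -
    have "module R M" "tor_GV R M = carrier M" using that(1) by (auto simp: GV_torsion_def)
    then have "x \<in> tor_GV R N" if "x \<in> carrier N" for x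
      using tor_GV_hom_inj[OF \<open>module R N\<close> _ \<open>f \<in> mod_hom R N M\<close> \<open>inj_on f (carrier N)\<close> that]
        mod_homD(1)[OF \<open>f \<in> mod_hom R N M\<close> that] by simp
    then have "tor_GV R N = carrier N" using tor_GV_subset[of R N] by blast
    then show ?thesis using that(2) by (simp add: GV_torsion_def)
  qed
  then show ?thesis unfolding closed_under_submodules_def by blast
qed

lemma GV_torsion_free_closed_under_submodules: "closed_under_submodules R (GV_torsion_free R)"
proof -
  have "N \<in> GV_torsion_free R" if "M \<in> GV_torsion_free R" and N: "module R N"
      and f: "f \<in> mod_hom R N M" and inj: "inj_on f (carrier N)"
    for M N :: "('a, 'm) module" and f
  proof -
    interpret N: module R N by fact
    have M: "module R M" "tor_GV R M = {\<zero>\<^bsub>M\<^esub>}" using that(1) by (auto simp: GV_torsion_free_def)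
    have "x = \<zero>\<^bsub>N\<^esub>" if x: "x \<in> tor_GV R N" for x
    proof -
      have "f x = f \<zero>\<^bsub>N\<^esub>" using tor_GV_hom[OF N M(1) f x] M(2) mod_hom_zero[OF N M(1) f] by simp
      moreover have "x \<in> carrier N" using x by (simp add: tor_GV_def)
      ultimately show ?thesis using inj by (simp add: inj_on_eq_iff)
    qed
    moreover have "\<zero>\<^bsub>N\<^esub> \<in> tor_GV R N"
      by (rule zero_in_tor_GV[OF N])
    ultimately have "tor_GV R N = {\<zero>\<^bsub>N\<^esub>}" by blast
    then show ?thesis using N by (simp add: GV_torsion_free_def)
  qed
  then show ?thesis unfolding closed_under_submodules_def by blast
qed

section \<open>Quotients inside the universe of the module\<close>

text \<open>An equivalence class is replaced by a chosen representative, so the quotient lives in the same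
  type as \<open>M\<close>: for \<open>g\<close> picking representatives modulo a submodule, \<open>rep_module M g\<close> is a
  copy of the quotient and \<open>g\<close> is the projection.\<close>

definition rep_module :: "('a, 'm) module \<Rightarrow> ('m \<Rightarrow> 'm) \<Rightarrow> ('a, 'm) module"
  where "rep_module M g = M\<lparr>carrier := g ` carrier M, zero := g \<zero>\<^bsub>M\<^esub>,
    add := (\<lambda>x y. g (x \<oplus>\<^bsub>M\<^esub> y)), smult := (\<lambda>r x. g (r \<odot>\<^bsub>M\<^esub> x))\<rparr>"

lemma quotient_in_same_type:
  fixes M :: "('a, 'm) module"
  assumes M: "module R M" and H: "submodule H R M"
  obtains N :: "('a, 'm) module" and g where "module R N" and "g \<in> mod_hom R M N"
    and "g ` carrier M = carrier N" and "a_kernel M N g = H"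
proof -
  interpret module R M by fact
  have H_zero: "\<zero>\<^bsub>M\<^esub> \<in> H"
    using subgroup.one_closed[OF submodule.axioms(1)[OF H]] by simp
  have H_sub: "H \<subseteq> carrier M"
    and H_neg: "\<And>x. x \<in> H \<Longrightarrow> \<ominus>\<^bsub>M\<^esub> x \<in> H"
    and H_add: "\<And>x y. x \<in> H \<Longrightarrow> y \<in> H \<Longrightarrow> x \<oplus>\<^bsub>M\<^esub> y \<in> H"
    and H_smult: "\<And>r x. r \<in> carrier R \<Longrightarrow> x \<in> H \<Longrightarrow> r \<odot>\<^bsub>M\<^esub> x \<in> H"
    using submoduleE[OF H] by auto
  define E where "E x = {y \<in> carrier M. \<exists>h\<in>H. y = x \<oplus>\<^bsub>M\<^esub> h}" for x
  define g where "g x = (SOME y. y \<in> E x)" for x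
  define N where "N = rep_module M g"
  have E_self: "x \<in> E x" if "x \<in> carrier M" for x
    unfolding E_def mem_Collect_eq using that H_zero
    by (intro conjI bexI[of _ "\<zero>\<^bsub>M\<^esub>"]) simp_all
  have g_E: "g x \<in> E x" if "x \<in> carrier M" for x
    unfolding g_def using E_self[OF that] by (rule someI)
  have g_in [simp]: "g x \<in> carrier M" if "x \<in> carrier M" for x
    using g_E[OF that] unfolding E_def by blast
  have E_eq: "E (x \<oplus>\<^bsub>M\<^esub> h) = E x" if x: "x \<in> carrier M" and h: "h \<in> H" for x h
  proof -
    have hc: "h \<in> carrier M" using h H_sub by blast
    have "\<exists>k\<in>H. x \<oplus>\<^bsub>M\<^esub> h \<oplus>\<^bsub>M\<^esub> l = x \<oplus>\<^bsub>M\<^esub> k" if l: "l \<in> H" for l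
      using x hc l h H_sub H_add by (intro bexI[of _ "h \<oplus>\<^bsub>M\<^esub> l"]) (auto simp: M.a_assoc)
    moreover have "\<exists>k\<in>H. x \<oplus>\<^bsub>M\<^esub> l = x \<oplus>\<^bsub>M\<^esub> h \<oplus>\<^bsub>M\<^esub> k" if l: "l \<in> H" for l
    proof (rule bexI[of _ "\<ominus>\<^bsub>M\<^esub> h \<oplus>\<^bsub>M\<^esub> l"])
      have "l \<in> carrier M" using l H_sub by blast
      then have "h \<oplus>\<^bsub>M\<^esub> (\<ominus>\<^bsub>M\<^esub> h \<oplus>\<^bsub>M\<^esub> l) = l" using hc by (simp add: M.r_neg2)
      then show "x \<oplus>\<^bsub>M\<^esub> l = x \<oplus>\<^bsub>M\<^esub> h \<oplus>\<^bsub>M\<^esub> (\<ominus>\<^bsub>M\<^esub> h \<oplus>\<^bsub>M\<^esub> l)"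
        using x hc \<open>l \<in> carrier M\<close> by (simp add: M.a_assoc)
    qed (use h l H_neg H_add in auto)
    ultimately have "(\<exists>k\<in>H. y = x \<oplus>\<^bsub>M\<^esub> h \<oplus>\<^bsub>M\<^esub> k) \<longleftrightarrow> (\<exists>k\<in>H. y = x \<oplus>\<^bsub>M\<^esub> k)" for y by metis
    then show ?thesis unfolding E_def by simp
  qed
  then have g_eq: "g (x \<oplus>\<^bsub>M\<^esub> h) = g x" if "x \<in> carrier M" "h \<in> H" for x h
    using that by (simp add: g_def)
  have g_obtain: "\<exists>h\<in>H. g x = x \<oplus>\<^bsub>M\<^esub> h" if "x \<in> carrier M" for x
    using g_E[OF that] unfolding E_def by blast
  have g_idem: "g (g x) = g x" if "x \<in> carrier M" for x
    using g_obtain[OF that] g_eq[OF that] by force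
  have g_add: "g (g x \<oplus>\<^bsub>M\<^esub> y) = g (x \<oplus>\<^bsub>M\<^esub> y)" if x: "x \<in> carrier M" and y: "y \<in> carrier M" for x y
  proof -
    obtain h where h: "h \<in> H" "g x = x \<oplus>\<^bsub>M\<^esub> h" using g_obtain[OF x] by blast
    have "h \<in> carrier M" using h H_sub by blast
    then have "g x \<oplus>\<^bsub>M\<^esub> y = (x \<oplus>\<^bsub>M\<^esub> y) \<oplus>\<^bsub>M\<^esub> h" using x y h by (simp add: M.a_ac)
    then show ?thesis using g_eq[OF _ h(1)] x y by simp
  qed
  have g_add': "g (y \<oplus>\<^bsub>M\<^esub> g x) = g (y \<oplus>\<^bsub>M\<^esub> x)" if "x \<in> carrier M" "y \<in> carrier M" for x y
    using g_add[OF that] that by (simp add: M.a_comm)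
  have g_smult: "g (r \<odot>\<^bsub>M\<^esub> g x) = g (r \<odot>\<^bsub>M\<^esub> x)" if r: "r \<in> carrier R" and x: "x \<in> carrier M" for r x
  proof -
    obtain h where h: "h \<in> H" "g x = x \<oplus>\<^bsub>M\<^esub> h" using g_obtain[OF x] by blast
    have "h \<in> carrier M" using h H_sub by blast
    then have "r \<odot>\<^bsub>M\<^esub> g x = r \<odot>\<^bsub>M\<^esub> x \<oplus>\<^bsub>M\<^esub> r \<odot>\<^bsub>M\<^esub> h" using x r h by (simp add: smult_r_distr)
    then show ?thesis using g_eq H_smult[OF r h(1)] r x by simp
  qed
  have N_simps: "carrier N = g ` carrier M" "zero N = g \<zero>\<^bsub>M\<^esub>"
    "\<And>x y. x \<oplus>\<^bsub>N\<^esub> y = g (x \<oplus>\<^bsub>M\<^esub> y)" "\<And>r x. r \<odot>\<^bsub>N\<^esub> x = g (r \<odot>\<^bsub>M\<^esub> x)"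
    by (auto simp: N_def rep_module_def)
  have carN: "\<exists>u. u \<in> carrier M \<and> x = g u" if "x \<in> carrier N" for x
    using that unfolding N_simps by blast
  note g_simps = N_simps g_idem g_add g_add' g_smult
  have N: "module R N"
  proof (rule moduleI)
    show "abelian_group N"
    proof (rule abelian_groupI)
      show "\<exists>y\<in>carrier N. y \<oplus>\<^bsub>N\<^esub> x = \<zero>\<^bsub>N\<^esub>" if x: "x \<in> carrier N" for x
      proof -
        obtain u where u: "u \<in> carrier M" "x = g u" using carN[OF x] by blast
        then show ?thesis
          by (intro bexI[of _ "g (\<ominus>\<^bsub>M\<^esub> u)"]) (auto simp: g_simps M.l_neg)
      qed
      show "x \<oplus>\<^bsub>N\<^esub> y \<oplus>\<^bsub>N\<^esub> z = x \<oplus>\<^bsub>N\<^esub> (y \<oplus>\<^bsub>N\<^esub> z)"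
        if "x \<in> carrier N" "y \<in> carrier N" "z \<in> carrier N" for x y z
        using that by (auto simp: g_simps M.a_assoc)
      show "x \<oplus>\<^bsub>N\<^esub> y = y \<oplus>\<^bsub>N\<^esub> x" if "x \<in> carrier N" "y \<in> carrier N" for x y
        using that by (auto simp: g_simps M.a_comm)
    qed (auto simp: g_simps)
    show "(a \<oplus>\<^bsub>R\<^esub> b) \<odot>\<^bsub>N\<^esub> x = a \<odot>\<^bsub>N\<^esub> x \<oplus>\<^bsub>N\<^esub> b \<odot>\<^bsub>N\<^esub> x"
      if "a \<in> carrier R" "b \<in> carrier R" "x \<in> carrier N" for a b x
      using that by (auto simp: g_simps) (simp add: smult_l_distr)
    show "(a \<otimes>\<^bsub>R\<^esub> b) \<odot>\<^bsub>N\<^esub> x = a \<odot>\<^bsub>N\<^esub> (b \<odot>\<^bsub>N\<^esub> x)"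
      if "a \<in> carrier R" "b \<in> carrier R" "x \<in> carrier N" for a b x
      using that by (auto simp: g_simps) (simp add: smult_assoc1)
  qed (use R.is_cring in \<open>auto simp: g_simps smult_r_distr\<close>)
  have hom: "g \<in> mod_hom R M N" by (auto simp: mod_hom_def hom_def g_simps)
  have "x \<in> H" if x: "x \<in> carrier M" and eq: "g x = g \<zero>\<^bsub>M\<^esub>" for x
  proof -
    obtain h where h: "h \<in> H" "g x = x \<oplus>\<^bsub>M\<^esub> h" using g_obtain[OF x] by blast
    obtain k where k: "k \<in> H" "g \<zero>\<^bsub>M\<^esub> = \<zero>\<^bsub>M\<^esub> \<oplus>\<^bsub>M\<^esub> k" using g_obtain[OF M.zero_closed] by blast
    have hc: "h \<in> carrier M" and kc: "k \<in> carrier M" using h k H_sub by auto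
    have "x = (x \<oplus>\<^bsub>M\<^esub> h) \<oplus>\<^bsub>M\<^esub> \<ominus>\<^bsub>M\<^esub> h" using x hc by (simp add: M.a_assoc M.r_neg)
    also have "\<dots> = k \<oplus>\<^bsub>M\<^esub> \<ominus>\<^bsub>M\<^esub> h" using h k kc eq by simp
    finally show ?thesis using H_add H_neg h k by metis
  qed
  moreover have "g x = g \<zero>\<^bsub>M\<^esub>" if "x \<in> H" for x
    using g_eq[OF M.zero_closed that] that H_sub by auto
  ultimately have "a_kernel M N g = H"
    unfolding a_kernel_def' N_simps using H_sub by blast
  with N hom N_simps(1)[symmetric] show thesis by (rule that)
qed

lemma torsion_exact_sequence:
  fixes M :: "('a, 'm) module"
  assumes M: "module R M"
  shows "\<exists>L\<in>GV_torsion R. \<exists>N\<in>GV_torsion_free R. \<exists>f g.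
    short_exact R (L :: ('a, 'm) module) f M g (N :: ('a, 'm) module)"
proof -
  interpret module R M by fact
  let ?T = "tor_GV R M"
  let ?L = "M\<lparr>carrier := ?T\<rparr>"
  have T: "submodule ?T R M" using M by (rule submodule_tor_GV)
  have T_sub: "?T \<subseteq> carrier M" by (rule tor_GV_subset)
  have L: "module R ?L" using submodule.submodule_is_module[OF T M] .
  have "tor_GV R ?L = {x \<in> ?T. \<exists>J\<in>GV R. \<forall>a\<in>J. a \<odot>\<^bsub>M\<^esub> x = \<zero>\<^bsub>M\<^esub>}" by (simp add: tor_GV_def)
  also have "\<dots> = carrier ?L" unfolding tor_GV_def by simp
  finally have "tor_GV R ?L = carrier ?L" .
  then have L_tor: "?L \<in> GV_torsion R" using L by (simp add: GV_torsion_def)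
  obtain N :: "('a, 'm) module" and g where N: "module R N" and g: "g \<in> mod_hom R M N"
    and im: "g ` carrier M = carrier N" and ker: "a_kernel M N g = ?T"
    by (rule quotient_in_same_type[OF M T])
  interpret N: module R N by fact
  have ker': "x \<in> ?T \<longleftrightarrow> g x = \<zero>\<^bsub>N\<^esub>" if "x \<in> carrier M" for x
    unfolding ker[symmetric] a_kernel_def' using that by blast
  have "y = \<zero>\<^bsub>N\<^esub>" if y: "y \<in> tor_GV R N" for y
  proof -
    obtain J where J: "y \<in> carrier N" "J \<in> GV R" "\<And>a. a \<in> J \<Longrightarrow> a \<odot>\<^bsub>N\<^esub> y = \<zero>\<^bsub>N\<^esub>"
      using y by (rule tor_GV_E) blast
    obtain x where x: "x \<in> carrier M" "y = g x" using J(1) im by blast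
    have "x \<in> ?T"
    proof (rule tor_GV_if_GV_multiples[OF M x(1) J(2)])
      fix a assume a: "a \<in> J"
      then have "a \<in> carrier R" using GV_ideal[OF J(2)] by (rule ideal.Icarr[rotated])
      then show "a \<odot>\<^bsub>M\<^esub> x \<in> ?T" using J(3)[OF a] mod_homD(3)[OF g] x ker' by simp
    qed
    then show ?thesis using ker' x by simp
  qed
  moreover have "\<zero>\<^bsub>N\<^esub> \<in> tor_GV R N" using N by (rule zero_in_tor_GV)
  ultimately have "tor_GV R N = {\<zero>\<^bsub>N\<^esub>}" by blast
  then have "N \<in> GV_torsion_free R" using N by (simp add: GV_torsion_free_def)
  moreover have "short_exact R ?L id M g N"
  proof -
    have "id \<in> mod_hom R ?L M" using T_sub by (auto simp: mod_hom_def hom_def)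
    then show ?thesis unfolding short_exact_def using g im ker by simp
  qed
  ultimately show ?thesis using L_tor by blast
qed

section \<open>Torsion cyclic modules\<close>

lemma (in cring) module_quot_module:
  assumes "ideal I R"
  shows "module R (quot_module R I)"
proof -
  interpret I: ideal I R by fact
  interpret Q: cring "R Quot I" using I.quotient_is_cring[OF is_cring] .
  interpret \<pi>: ring_hom_ring R "R Quot I" "(+>) I" by (rule I.rcos_ring_hom_ring)
  have "abelian_group (quot_module R I)"
  proof (rule abelian_groupI)
    show "\<exists>y\<in>carrier (quot_module R I). y \<oplus>\<^bsub>quot_module R I\<^esub> x = \<zero>\<^bsub>quot_module R I\<^esub>"
      if "x \<in> carrier (quot_module R I)" for x
      using that Q.l_neg[of x] by (auto simp: quot_module_def intro: Q.a_inv_closed)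
  qed (auto simp: quot_module_def Q.a_ac)
  then show ?thesis
    by (intro moduleI is_cring)
      (auto simp: quot_module_def Q.l_distr Q.r_distr Q.m_assoc)
qed

lemma (in cring) quot_module_torsion_iff:
  assumes "ideal I R"
  shows "quot_module R I \<in> GV_torsion R \<longleftrightarrow> (\<exists>J\<in>GV R. J \<subseteq> I)"
proof -
  interpret I: ideal I R by fact
  have zero: "\<zero>\<^bsub>R Quot I\<^esub> = I" by (simp only: FactRing_def ring.simps)
  interpret Q: cring "R Quot I" using I.quotient_is_cring[OF is_cring] .
  interpret \<pi>: ring_hom_ring R "R Quot I" "(+>) I" by (rule I.rcos_ring_hom_ring)
  have coset: "I +> a = I \<longleftrightarrow> a \<in> I" if "a \<in> carrier R" for a
    using I.rcos_const_imp_mem[OF that] I.a_rcos_const[of a] by auto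
  show ?thesis
  proof
    assume "quot_module R I \<in> GV_torsion R"
    then have "\<one>\<^bsub>R Quot I\<^esub> \<in> tor_GV R (quot_module R I)"
      using Q.one_closed by (simp add: GV_torsion_def quot_module_def)
    then have "\<exists>J\<in>GV R. \<forall>a\<in>J. (I +> a) \<otimes>\<^bsub>R Quot I\<^esub> \<one>\<^bsub>R Quot I\<^esub> = \<zero>\<^bsub>R Quot I\<^esub>"
      by (simp add: tor_GV_def quot_module_def)
    then obtain J where J: "J \<in> GV R"
        "\<forall>a\<in>J. (I +> a) \<otimes>\<^bsub>R Quot I\<^esub> \<one>\<^bsub>R Quot I\<^esub> = \<zero>\<^bsub>R Quot I\<^esub>"
      by blast
    interpret J: ideal J R using J(1) by (rule GV_ideal)
    have "a \<in> I" if "a \<in> J" for a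
    proof -
      have a: "a \<in> carrier R" using that by (rule J.Icarr)
      then have "I +> a = I" using bspec[OF J(2) that] zero by simp
      then show ?thesis using coset[OF a] by simp
    qed
    then show "\<exists>J\<in>GV R. J \<subseteq> I" using J(1) by blast
  next
    assume "\<exists>J\<in>GV R. J \<subseteq> I"
    then obtain J where J: "J \<in> GV R" "J \<subseteq> I" by blast
    have "X \<in> tor_GV R (quot_module R I)" if X: "X \<in> carrier (quot_module R I)" for X
    proof (rule tor_GV_I[OF X J(1)])
      fix a assume "a \<in> J"
      then have "a \<in> I" using J(2) by blast
      then have "I +> a = \<zero>\<^bsub>R Quot I\<^esub>" unfolding zero by (rule I.a_rcos_const)
      then show "a \<odot>\<^bsub>quot_module R I\<^esub> X = \<zero>\<^bsub>quot_module R I\<^esub>"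
        using X by (simp add: quot_module_def)
    qed
    then have "tor_GV R (quot_module R I) = carrier (quot_module R I)"
      using tor_GV_subset[of R "quot_module R I"] by blast
    then show "quot_module R I \<in> GV_torsion R"
      using module_quot_module[OF assms] by (simp add: GV_torsion_def)
  qed
qed

section \<open>The torsion theory and its Gabriel filter\<close>

lemma GV_torsion_Int_torsion_free:
  fixes R :: "('a, 'e) ring_scheme"
  shows "(GV_torsion R :: ('a, 'm) module set) \<inter> GV_torsion_free R = {M. module R M \<and> carrier M = {\<zero>\<^bsub>M\<^esub>}}"
proof -
  have "tor_GV R M = {\<zero>\<^bsub>M\<^esub>}" if "module R M" "carrier M = {\<zero>\<^bsub>M\<^esub>}" for M :: "('a, 'm) module"
    using zero_in_tor_GV[OF that(1)] tor_GV_subset[of R M] that(2) by blast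
  then show ?thesis unfolding GV_torsion_def GV_torsion_free_def by auto
qed

theorem mainTheorem5:
  fixes R :: "('a, 'e) ring_scheme"
  assumes "cring R"
  shows "hereditary_torsion_theory R
           (tau_w R :: ('a, 'm) module set \<times> ('a, 'm) module set) \<and>
         gabriel_filter R (tau_w R) = {I. ideal I R \<and> (\<exists>J\<in>GV R. J \<subseteq> I)}"
proof
  have "torsion_theory R (tau_w R :: ('a, 'm) module set \<times> ('a, 'm) module set)"
    unfolding torsion_theory_def tau_w_def prod.case
  proof (intro conjI allI impI)
    show "\<forall>M\<in>GV_torsion R \<union> GV_torsion_free R :: ('a, 'm) module set. module R M"
      by (auto simp: GV_torsion_def GV_torsion_free_def)
  qed (rule GV_torsion_Int_torsion_free GV_torsion_closed_under_images
      GV_torsion_free_closed_under_submodules torsion_exact_sequence, assumption?)+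
  then show "hereditary_torsion_theory R
      (tau_w R :: ('a, 'm) module set \<times> ('a, 'm) module set)"
    using GV_torsion_closed_under_submodules
    by (simp add: hereditary_torsion_theory_def tau_w_def)
  show "gabriel_filter R (tau_w R) = {I. ideal I R \<and> (\<exists>J\<in>GV R. J \<subseteq> I)}"
    using cring.quot_module_torsion_iff[OF assms] by (auto simp: gabriel_filter_def tau_w_def)
qed

end
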